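(* There exists a mixing operator (a continuous linear operator on a separable $F$-space) which is not reiteratively hypercyclic.
   Context: An $F$-space is a topological vector space whose topology is induced by a complete translation-invariant metric. A continuous linear operator $T$ on $X$ is mixing if for any non-empty open sets $U,V\subset X$ there exists $n_0$ such that $T^nU\cap V\ne\emptyset$ for all $n\ge n_0$. For $A\subseteq\mathbb{Z}_+$ (the non-negative integers), the upper Banach density is $\overline{Bd}(A)=\lim_{s\to\infty}\alpha^s/s$, where $\alpha^s=\limsup_{k\to\infty}|A\cap[k+1,k+s]|$ (the limit always exists). For $x\in X$ and $V\subset X$, $N(x,V)=\{n\ge0:T^nx\in V\}$. $T$ is reiteratively hypercyclic if there exists $x\in X$ such that $\overline{Bd}(N(x,V))>0$ for every non-empty open $V\subset X$. *)

theory Defs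
  imports "HOL-Analysis.Analysis" "HOL-Library.Function_Algebras"
begin

section \<open>F-spaces\<close>

text \<open>
  A topological vector space is given by a scalar multiplication on an ambient vector space type
  and a topology whose underlying set is a linear subspace of that type.
\<close>

definition tvs_on :: "('k::real_normed_field \<Rightarrow> 'a::ab_group_add \<Rightarrow> 'a) \<Rightarrow> 'a topology \<Rightarrow> bool"
  where "tvs_on smul X \<longleftrightarrow>
     vector_space smul \<and>
     module.subspace smul (topspace X) \<and>
     continuous_map (prod_topology X X) X (\<lambda>(x, y). x + y) \<and>
     continuous_map (prod_topology euclidean X) X (\<lambda>(c, x). smul c x)"

definition f_space :: "('k::real_normed_field \<Rightarrow> 'a::ab_group_add \<Rightarrow> 'a) \<Rightarrow> 'a topology \<Rightarrow> bool"
  where "f_space smul X \<longleftrightarrow>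
     tvs_on smul X \<and>
     (\<exists>d. Metric_space (topspace X) d \<and>
          Metric_space.mcomplete (topspace X) d \<and>
          Metric_space.mtopology (topspace X) d = X \<and>
          (\<forall>x\<in>topspace X. \<forall>y\<in>topspace X. \<forall>z\<in>topspace X. d (x + z) (y + z) = d x y))"

text \<open>Only the values of an operator on the underlying set of the space are relevant.\<close>

definition continuous_linear_operator ::
    "('k::real_normed_field \<Rightarrow> 'a::ab_group_add \<Rightarrow> 'a) \<Rightarrow> 'a topology \<Rightarrow> ('a \<Rightarrow> 'a) \<Rightarrow> bool"
  where "continuous_linear_operator smul X T \<longleftrightarrow>
     continuous_map X X T \<and>
     (\<forall>x\<in>topspace X. \<forall>y\<in>topspace X. T (x + y) = T x + T y) \<and>
     (\<forall>c. \<forall>x\<in>topspace X. T (smul c x) = smul c (T x))"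

text \<open>
  The ambient space used for existence statements: all scalar sequences.  Its algebraic dimension
  is that of the continuum, and a separable F-space has at most continuum many elements, so every
  separable F-space over the reals or the complex numbers is isomorphic to one whose underlying
  set is a linear subspace of this space.  The topology on that subspace is arbitrary; it need not
  be related to the product topology.
\<close>

definition seq_scale :: "'k::real_normed_field \<Rightarrow> (nat \<Rightarrow> 'k) \<Rightarrow> (nat \<Rightarrow> 'k)"
  where "seq_scale c x = (\<lambda>n. c * x n)"

lemma vector_space_seq_scale: "vector_space seq_scale"
  by unfold_locales (auto simp: seq_scale_def algebra_simps)


section \<open>Dynamics\<close>

definition mixing :: "'a topology \<Rightarrow> ('a \<Rightarrow> 'a) \<Rightarrow> bool"
  where "mixing X T \<longleftrightarrow>
     (\<forall>U V. openin X U \<and> U \<noteq> {} \<and> openin X V \<and> V \<noteq> {} \<longrightarrow>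
        (\<exists>n0. \<forall>n\<ge>n0. (T ^^ n) ` U \<inter> V \<noteq> {}))"

definition return_set :: "('a \<Rightarrow> 'a) \<Rightarrow> 'a \<Rightarrow> 'a set \<Rightarrow> nat set"
  where "return_set T x V = {n. (T ^^ n) x \<in> V}"

definition banach_alpha :: "nat set \<Rightarrow> nat \<Rightarrow> ereal"
  where "banach_alpha A s = limsup (\<lambda>k. ereal (real (card (A \<inter> {k+1..k+s}))))"

definition upper_banach_density :: "nat set \<Rightarrow> ereal"
  where "upper_banach_density A = lim (\<lambda>s. banach_alpha A s / ereal (real s))"

definition reiteratively_hypercyclic :: "'a topology \<Rightarrow> ('a \<Rightarrow> 'a) \<Rightarrow> bool"
  where "reiteratively_hypercyclic X T \<longleftrightarrow>
     (\<exists>x\<in>topspace X. \<forall>V. openin X V \<and> V \<noteq> {} \<longrightarrow> upper_banach_density (return_set T x V) > 0)"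


section \<open>The upper Banach density is a genuine limit\<close>

lemma banach_alpha_nonneg: "0 \<le> banach_alpha A s"
  unfolding banach_alpha_def
  by (rule le_Limsup) auto

lemma banach_alpha_le: "banach_alpha A s \<le> ereal (real s)"
  unfolding banach_alpha_def
proof (rule Limsup_bounded, rule always_eventually, rule allI)
  fix k
  have "card (A \<inter> {k+1..k+s}) \<le> card {k+1..k+s}" by (rule card_mono) auto
  then show "ereal (real (card (A \<inter> {k+1..k+s}))) \<le> ereal (real s)" by simp
qed

lemma banach_alpha_add: "banach_alpha A (s + t) \<le> banach_alpha A s + banach_alpha A t"
proof -
  let ?f = "\<lambda>s k. ereal (real (card (A \<inter> {k+1..k+s})))"
  have "card (A \<inter> {k+1..k+(s+t)}) \<le> card (A \<inter> {k+1..k+s}) + card (A \<inter> {k+s+1..k+s+t})" for k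
  proof -
    have "A \<inter> {k+1..k+(s+t)} \<subseteq> (A \<inter> {k+1..k+s}) \<union> (A \<inter> {k+s+1..k+s+t})" by auto
    then have "card (A \<inter> {k+1..k+(s+t)}) \<le> card ((A \<inter> {k+1..k+s}) \<union> (A \<inter> {k+s+1..k+s+t}))"
      by (intro card_mono) auto
    also have "\<dots> \<le> card (A \<inter> {k+1..k+s}) + card (A \<inter> {k+s+1..k+s+t})" by (rule card_Un_le)
    finally show ?thesis .
  qed
  then have "?f (s+t) k \<le> ?f s k + ?f t (k + s)" for k
    by (metis ereal_less_eq(3) of_nat_add of_nat_le_iff plus_ereal.simps(1))
  then have "limsup (?f (s+t)) \<le> limsup (\<lambda>k. ?f s k + ?f t (k + s))"
    by (intro Limsup_mono always_eventually) blast
  also have "\<dots> \<le> limsup (?f s) + limsup (\<lambda>k. ?f t (k + s))"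
    by (rule ereal_limsup_add_mono)
  also have "limsup (\<lambda>k. ?f t (k + s)) = limsup (?f t)"
    by (rule limsup_shift_k)
  finally show ?thesis unfolding banach_alpha_def .
qed

lemma banach_alpha_quotient_tendsto:
  "(\<lambda>s. banach_alpha A s / ereal (real s)) \<longlonglongrightarrow> upper_banach_density A"
proof -
  define b where "b s = real_of_ereal (banach_alpha A s)" for s
  have b: "banach_alpha A s = ereal (b s)" for s
    using banach_alpha_nonneg[of A s] banach_alpha_le[of A s] unfolding b_def
    by (cases "banach_alpha A s") auto
  have b0: "0 \<le> b s" and bs: "b s \<le> real s" for s
    using banach_alpha_nonneg[of A s] banach_alpha_le[of A s] by (auto simp: b)
  have badd: "b (s + t) \<le> b s + b t" for s t
    using banach_alpha_add[of A s t] by (simp add: b)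
  have bmul: "b (q * m + r) \<le> real q * b m + real r" for q m r
  proof (induction q)
    case 0 then show ?case using bs by simp
  next
    case (Suc q)
    have "b (Suc q * m + r) \<le> b m + b (q * m + r)"
      using badd[of m "q * m + r"] by (simp add: add.assoc)
    with Suc show ?case by (simp add: algebra_simps)
  qed
  define L where "L = (INF m\<in>{1..}. b m / real m)"
  have bdd: "bdd_below ((\<lambda>m. b m / real m) ` {1..})"
    by (rule bdd_belowI[of _ 0]) (use b0 in auto)
  have lim: "(\<lambda>s. b s / real s) \<longlonglongrightarrow> L"
  proof (rule LIMSEQ_I)
    fix e :: real assume e: "e > 0"
    have "\<exists>m\<in>{1..}. b m / real m < L + e/2"
      using cINF_less_iff[of "{1::nat..}" "\<lambda>m. b m / real m" "L + e/2"] bdd e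
      by (auto simp: L_def)
    then obtain m where m: "m \<ge> 1" "b m / real m < L + e/2" by auto
    obtain N where N: "real N > 2 * real m / e" using reals_Archimedean2 by blast
    have "norm (b s / real s - L) < e" if s: "s \<ge> max N 1" for s
    proof -
      have sp: "s \<ge> 1" using s by simp
      have lo: "L \<le> b s / real s"
        unfolding L_def using bdd sp by (intro cINF_lower) auto
      have "b s \<le> real (s div m) * b m + real (s mod m)"
        using bmul[of "s div m" m "s mod m"] by simp
      also have "real (s div m) * b m \<le> (real s / real m) * b m"
        using b0 by (intro mult_right_mono of_nat_div_le_of_nat) auto
      also have "real (s mod m) \<le> real m" using m by (simp add: less_imp_le)
      finally have "b s \<le> real s * (b m / real m) + real m" by simp
      then have "b s / real s \<le> b m / real m + real m / real s"
        using sp by (simp add: field_simps)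
      also have "real m / real s < e / 2"
      proof -
        have "2 * real m / e < real s" using N s by linarith
        then show ?thesis using e sp by (simp add: field_simps)
      qed
      finally have "b s / real s < L + e" using m by linarith
      with lo show ?thesis by simp
    qed
    then show "\<exists>no. \<forall>n\<ge>no. norm (b n / real n - L) < e" by blast
  qed
  have "(\<lambda>s. ereal (b s / real s)) \<longlonglongrightarrow> ereal L" using lim by simp
  moreover have "\<forall>\<^sub>F s in sequentially. ereal (b s / real s) = banach_alpha A s / ereal (real s)"
    using eventually_gt_at_top[of 0] by eventually_elim (simp add: b)
  ultimately have "(\<lambda>s. banach_alpha A s / ereal (real s)) \<longlonglongrightarrow> ereal L"
    by (rule Lim_transform_eventually)
  then show ?thesis unfolding upper_banach_density_def by (simp add: limI)
qed

end

theory Submission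
  imports Defs "HOL-Real_Asymp.Real_Asymp"
begin

text \<open>
  The operator is the backward shift \<open>T\<close> on the weighted space
  \<open>\<ell>\<^sup>1(v) = {x. \<Sum>n. v n * \<bar>x n\<bar> < \<infinity>}\<close> for a decreasing weight \<open>v\<close> that tends to \<open>0\<close>, but so
  slowly that \<open>n * v n \<rightarrow> \<infinity>\<close>; the theorem uses \<open>v n = 1 / sqrt (n + 1)\<close>.  The operator is continuous
  because neighbouring weights are comparable, \<open>v n \<le> K * v (n + 1)\<close>.

  Mixing comes from \<open>v n \<rightarrow> 0\<close>.  Finitely supported sequences are dense and are killed by high
  powers of \<open>T\<close>, while a finitely supported \<open>y\<close> has the preimage \<open>S\<^sup>n y\<close> under \<open>T\<^sup>n\<close> (with \<open>S\<close> the
  forward shift), which is small because its entries are moved to places of small weight.  Hence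
  \<open>x + S\<^sup>n y\<close> is close to \<open>x\<close> and is mapped to \<open>y\<close>, for all large \<open>n\<close>
  (\<open>mixing_bshift\<close>).

  The slow decay rules out reiterative hypercyclicity.  If \<open>T\<^sup>n x\<close> lies within \<open>v 0 / 2\<close> of the
  unit vector \<open>e\<^sub>0\<close>, then \<open>\<bar>x n\<bar> > 1/2\<close> and \<open>T\<^sup>n x\<close> has norm at most \<open>3/2 * v 0\<close>.  Suppose that a
  window of length \<open>s\<close> contains \<open>k\<close> such times and that \<open>n\<close> is the first of them.  Every one of them
  contributes at least \<open>v s / 2\<close> to the norm of \<open>T\<^sup>n x\<close>, so that \<open>k \<le> 3 * v 0 / v s\<close>.  This is
  \<open>o(s)\<close> uniformly in the position of the window, whence the set of these times has upper Banach
  density \<open>0\<close> (\<open>card_return_set_window\<close>, \<open>not_reiteratively_hypercyclic_bshift\<close>).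
\<close>

section \<open>Weighted summable sequences\<close>

locale decreasing_weight =
  fixes v :: "nat \<Rightarrow> real" and K :: real
  assumes v_pos: "0 < v n"
    and v_antimono: "m \<le> n \<Longrightarrow> v n \<le> v m"
    and v_shift: "v n \<le> K * v (Suc n)"
begin

definition wl1 :: "(nat \<Rightarrow> 'k::real_normed_field) set"
  where "wl1 = {x. (\<lambda>n. v n * norm (x n)) summable_on UNIV}"

text \<open>
  The metric axioms demand nonnegativity also at points outside the space.  The unordered sum
  provides it, being \<open>0\<close> where it diverges.
\<close>

definition wnorm :: "(nat \<Rightarrow> 'k::real_normed_field) \<Rightarrow> real"
  where "wnorm x = (\<Sum>\<^sub>\<infinity>n. v n * norm (x n))"

definition wdist :: "(nat \<Rightarrow> 'k::real_normed_field) \<Rightarrow> (nat \<Rightarrow> 'k) \<Rightarrow> real"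
  where "wdist x y = wnorm (x - y)"

abbreviation wtop :: "(nat \<Rightarrow> 'k::real_normed_field) topology"
  where "wtop \<equiv> Metric_space.mtopology wl1 wdist"

lemma v_nonneg: "0 \<le> v n"
  using v_pos[of n] by simp

lemma K_nonneg: "0 \<le> K"
proof -
  have "0 < K * v (Suc 0)" using v_pos[of 0] v_shift[of 0] by linarith
  then show ?thesis using v_pos[of "Suc 0"] by (simp add: zero_less_mult_iff)
qed

lemma term_nonneg: "0 \<le> v n * norm (x n)"
  by (simp add: v_nonneg)

lemma wnorm_nonneg: "0 \<le> wnorm x"
  unfolding wnorm_def by (intro infsum_nonneg term_nonneg)

text \<open>
  Membership in the space and a bound for the norm are both read off from the finite partial sums.
  This is how limits, sums and shifts of sequences are treated below.
\<close>

lemma wl1_finite_sums: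
  assumes "\<And>F. finite F \<Longrightarrow> (\<Sum>n\<in>F. v n * norm (x n)) \<le> B"
  shows "x \<in> wl1" and "wnorm x \<le> B"
proof -
  have s: "(\<lambda>n. v n * norm (x n)) summable_on UNIV"
    using assms by (intro nonneg_bdd_above_summable_on term_nonneg bdd_aboveI[of _ B]) auto
  then show "x \<in> wl1" by (simp add: wl1_def)
  show "wnorm x \<le> B"
    unfolding wnorm_def using s assms by (intro infsum_le_finite_sums) auto
qed

lemma finite_sum_le_wnorm:
  assumes "x \<in> wl1" "finite F"
  shows "(\<Sum>n\<in>F. v n * norm (x n)) \<le> wnorm x"
  using assms unfolding wl1_def wnorm_def by (intro finite_sum_le_infsum term_nonneg) auto

lemma coord_le_wnorm: "x \<in> wl1 \<Longrightarrow> v n * norm (x n) \<le> wnorm x"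
  using finite_sum_le_wnorm[of x "{n}"] by simp

lemma wnorm_add:
  assumes "x \<in> wl1" "y \<in> wl1"
  shows "x + y \<in> wl1" and "wnorm (x + y) \<le> wnorm x + wnorm y"
proof -
  have bound: "(\<Sum>n\<in>F. v n * norm ((x + y) n)) \<le> wnorm x + wnorm y" if "finite F" for F
  proof -
    have "(\<Sum>n\<in>F. v n * norm ((x + y) n)) \<le> (\<Sum>n\<in>F. v n * norm (x n) + v n * norm (y n))"
      unfolding distrib_left[symmetric]
      by (intro sum_mono mult_left_mono) (auto simp: norm_triangle_ineq v_nonneg)
    also have "\<dots> = (\<Sum>n\<in>F. v n * norm (x n)) + (\<Sum>n\<in>F. v n * norm (y n))"
      by (rule sum.distrib)
    also have "\<dots> \<le> wnorm x + wnorm y"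
      using assms that by (intro add_mono finite_sum_le_wnorm)
    finally show ?thesis .
  qed
  show "x + y \<in> wl1" and "wnorm (x + y) \<le> wnorm x + wnorm y"
    using wl1_finite_sums[of "x + y", OF bound] by auto
qed

lemma
  assumes "x \<in> wl1"
  shows seq_scale_mem: "seq_scale c x \<in> wl1"
    and wnorm_seq_scale: "wnorm (seq_scale c x) = norm c * wnorm x"
proof -
  have eq: "(\<lambda>n. v n * norm (seq_scale c x n)) = (\<lambda>n. norm c * (v n * norm (x n)))"
    by (auto simp: seq_scale_def norm_mult)
  show "seq_scale c x \<in> wl1"
    using assms unfolding wl1_def mem_Collect_eq eq by (rule summable_on_cmult_right)
  show "wnorm (seq_scale c x) = norm c * wnorm x"
    unfolding wnorm_def eq by (rule infsum_cmult_right')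
qed

lemma finite_support_mem:
  assumes "\<And>n. n \<ge> N \<Longrightarrow> x n = 0"
  shows "x \<in> wl1" and "wnorm x = (\<Sum>n<N. v n * norm (x n))"
proof -
  have neutral: "v n * norm (x n) = 0" if "n \<in> UNIV - {..<N}" for n
    using assms that by auto
  have "(\<lambda>n. v n * norm (x n)) summable_on UNIV \<longleftrightarrow> (\<lambda>n. v n * norm (x n)) summable_on {..<N}"
    using neutral by (intro summable_on_cong_neutral) auto
  then show "x \<in> wl1" by (simp add: wl1_def)
  have "wnorm x = (\<Sum>\<^sub>\<infinity>n\<in>{..<N}. v n * norm (x n))"
    unfolding wnorm_def using neutral by (intro infsum_cong_neutral) auto
  then show "wnorm x = (\<Sum>n<N. v n * norm (x n))" by simp
qed

lemma zero_mem: "0 \<in> wl1" and wnorm_zero: "wnorm 0 = 0"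
  by (auto simp: wl1_def wnorm_def)

lemma diff_mem:
  assumes "x \<in> wl1" "y \<in> wl1"
  shows "x - y \<in> wl1"
proof -
  have "- y \<in> wl1" using assms(2) by (simp add: wl1_def)
  then show ?thesis using wnorm_add(1)[OF assms(1), of "- y"] by simp
qed

lemma wdist_commute: "wdist x y = wdist y x"
  by (simp add: wdist_def wnorm_def norm_minus_commute)

lemma wdist_triangle:
  assumes "x \<in> wl1" "y \<in> wl1" "z \<in> wl1"
  shows "wdist x z \<le> wdist x y + wdist y z"
  using wnorm_add(2)[of "x - y" "y - z"] assms by (simp add: diff_mem wdist_def)

lemma Metric_space_wl1: "Metric_space (wl1 :: (nat \<Rightarrow> 'k::real_normed_field) set) wdist"
proof
  fix x y z :: "nat \<Rightarrow> 'k"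
  show "0 \<le> wdist x y" by (simp add: wdist_def wnorm_nonneg)
  show "wdist x y = wdist y x" by (rule wdist_commute)
  assume xy: "x \<in> wl1" "y \<in> wl1"
  show "wdist x y = 0 \<longleftrightarrow> x = y"
  proof
    assume "wdist x y = 0"
    then have "v n * norm (x n - y n) \<le> 0" for n
      using coord_le_wnorm[OF diff_mem[OF xy], of n] by (simp add: wdist_def)
    then have "norm (x n - y n) \<le> 0" for n
      using v_pos[of n] by (meson mult_pos_pos not_le)
    then show "x = y" by auto
  qed (simp add: wdist_def wnorm_zero)
  assume "z \<in> wl1"
  then show "wdist x z \<le> wdist x y + wdist y z" using xy by (intro wdist_triangle)
qed

lemma wdist_add_right: "wdist (x + z) (y + z) = wdist x y"
  by (simp add: wdist_def)

text \<open>
  A Cauchy sequence converges in each coordinate since every weight is positive; the coordinatewise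
  limit is then the limit in norm.
\<close>

lemma mcomplete_wl1:
  "Metric_space.mcomplete (wl1 :: (nat \<Rightarrow> 'k::{real_normed_field,banach}) set) wdist"
proof -
  interpret Metric_space "wl1 :: (nat \<Rightarrow> 'k) set" wdist by (rule Metric_space_wl1)
  show ?thesis unfolding mcomplete_def
  proof (intro allI impI)
    fix \<sigma> :: "nat \<Rightarrow> nat \<Rightarrow> 'k"
    assume "MCauchy \<sigma>"
    then have mem: "\<And>p. \<sigma> p \<in> wl1"
      and cauchy: "\<And>e. e > 0 \<Longrightarrow> \<exists>N. \<forall>p q. N \<le> p \<longrightarrow> N \<le> q \<longrightarrow> wdist (\<sigma> p) (\<sigma> q) < e"
      by (auto simp: MCauchy_def)
    have "Cauchy (\<lambda>p. \<sigma> p n)" for n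
    proof (rule metric_CauchyI)
      fix e :: real assume "e > 0"
      then obtain N where N: "\<And>p q. N \<le> p \<Longrightarrow> N \<le> q \<Longrightarrow> wdist (\<sigma> p) (\<sigma> q) < v n * e"
        using cauchy[of "v n * e"] v_pos[of n] by auto
      have "dist (\<sigma> p n) (\<sigma> q n) < e" if "p \<ge> N" "q \<ge> N" for p q
      proof -
        have "v n * norm ((\<sigma> p - \<sigma> q) n) < v n * e"
          using coord_le_wnorm[OF diff_mem[OF mem mem], of n p q] N[OF that]
          unfolding wdist_def by linarith
        then show ?thesis using v_pos[of n] by (simp add: dist_norm)
      qed
      then show "\<exists>M. \<forall>p\<ge>M. \<forall>q\<ge>M. dist (\<sigma> p n) (\<sigma> q n) < e" by blast
    qed
    then have "\<forall>n. \<exists>l. (\<lambda>p. \<sigma> p n) \<longlonglongrightarrow> l"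
      by (simp add: Cauchy_convergent flip: convergent_def)
    from choice[OF this] obtain x where x: "\<And>n. (\<lambda>p. \<sigma> p n) \<longlonglongrightarrow> x n"
      by blast
    \<comment> \<open>the Cauchy estimate survives the passage to the limit in each finite partial sum\<close>
    have close: "\<exists>N. \<forall>p\<ge>N. \<sigma> p - x \<in> wl1 \<and> wnorm (\<sigma> p - x) \<le> e" if e: "e > 0" for e
    proof -
      obtain N where N: "\<And>p q. N \<le> p \<Longrightarrow> N \<le> q \<Longrightarrow> wdist (\<sigma> p) (\<sigma> q) < e"
        using cauchy[OF e] by blast
      have bound: "(\<Sum>n\<in>F. v n * norm ((\<sigma> p - x) n)) \<le> e" if p: "p \<ge> N" and F: "finite F" for p F
      proof (rule LIMSEQ_le_const2)
        show "(\<lambda>q. \<Sum>n\<in>F. v n * norm ((\<sigma> p - \<sigma> q) n))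
                \<longlonglongrightarrow> (\<Sum>n\<in>F. v n * norm ((\<sigma> p - x) n))"
          unfolding fun_diff_def by (intro tendsto_intros x)
        have "(\<Sum>n\<in>F. v n * norm ((\<sigma> p - \<sigma> q) n)) \<le> e" if "q \<ge> N" for q
          using finite_sum_le_wnorm[OF diff_mem[OF mem[of p] mem[of q]] F] N[OF p that]
          unfolding wdist_def by linarith
        then show "\<exists>M. \<forall>q\<ge>M. (\<Sum>n\<in>F. v n * norm ((\<sigma> p - \<sigma> q) n)) \<le> e" by blast
      qed
      have "\<sigma> p - x \<in> wl1 \<and> wnorm (\<sigma> p - x) \<le> e" if "p \<ge> N" for p
        by (intro conjI wl1_finite_sums[of "\<sigma> p - x", OF bound[OF that]])
      then show ?thesis by blast
    qed
    obtain p where "\<sigma> p - x \<in> wl1" using close[of 1] by auto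
    from diff_mem[OF mem[of p] this] have xmem: "x \<in> wl1" by simp
    have "\<exists>N. \<forall>p\<ge>N. \<sigma> p \<in> wl1 \<and> wdist (\<sigma> p) x < e" if "e > 0" for e
      using close[of "e / 2"] that mem by (force simp: wdist_def)
    then show "\<exists>x. limitin mtopology \<sigma> x sequentially"
      using xmem unfolding limit_metric_sequentially by blast
  qed
qed

section \<open>The weighted sequence space as a separable F-space\<close>

lemma continuous_map_wtop_add:
  "continuous_map (prod_topology wtop wtop) (wtop :: (nat \<Rightarrow> 'k::real_normed_field) topology)
     (\<lambda>(x, y). x + y)"
proof -
  interpret Metric_space "wl1 :: (nat \<Rightarrow> 'k) set" wdist by (rule Metric_space_wl1)
  show ?thesis unfolding continuous_map_to_metric
  proof (intro ballI allI impI)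
    fix p :: "(nat \<Rightarrow> 'k) \<times> (nat \<Rightarrow> 'k)" and e :: real
    assume "p \<in> topspace (prod_topology mtopology mtopology)" and e: "0 < e"
    then obtain x y where p: "p = (x, y)" and *: "x \<in> wl1" "y \<in> wl1" by auto
    have "x' + y' \<in> mball (x + y) e" if "x' \<in> mball x (e/2)" "y' \<in> mball y (e/2)" for x' y'
    proof -
      have mem: "x' \<in> wl1" "y' \<in> wl1" using that by auto
      have "wdist (x + y) (x' + y') \<le> wdist x x' + wdist y y'"
        using wnorm_add(2)[OF diff_mem[OF *(1) mem(1)] diff_mem[OF *(2) mem(2)]]
        by (simp add: wdist_def algebra_simps)
      then show ?thesis using * that by (simp add: wnorm_add(1))
    qed
    moreover have "openin (prod_topology mtopology mtopology) (mball x (e/2) \<times> mball y (e/2))"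
      by (simp add: openin_prod_Times_iff)
    ultimately show "\<exists>U. openin (prod_topology mtopology mtopology) U \<and> p \<in> U \<and>
        (\<forall>q\<in>U. (case q of (x, y) \<Rightarrow> x + y) \<in> mball (case p of (x, y) \<Rightarrow> x + y) e)"
      using * e p by (intro exI[of _ "mball x (e/2) \<times> mball y (e/2)"]) auto
  qed
qed

lemma continuous_map_wtop_scale:
  "continuous_map (prod_topology euclidean wtop) (wtop :: (nat \<Rightarrow> 'k::real_normed_field) topology)
     (\<lambda>(c, x). seq_scale c x)"
proof -
  interpret Metric_space "wl1 :: (nat \<Rightarrow> 'k) set" wdist by (rule Metric_space_wl1)
  show ?thesis unfolding continuous_map_to_metric
  proof (intro ballI allI impI)
    fix p :: "'k \<times> (nat \<Rightarrow> 'k)" and e :: real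
    assume "p \<in> topspace (prod_topology euclidean mtopology)" and e: "0 < e"
    then obtain c x where p: "p = (c, x)" and x: "x \<in> wl1" by auto
    \<comment> \<open>chosen for \<open>c x - c' x' = (c - c') x + c' (x - x')\<close>, both terms to be at most \<open>e / 2\<close>;
       the \<open>1\<close> in \<open>b\<close> bounds \<open>\<bar>c'\<bar>\<close> by \<open>\<bar>c\<bar> + 1\<close>\<close>
    define a where "a = e / (2 * (norm c + 1))"
    define b where "b = min 1 (e / (2 * (wnorm x + 1)))"
    have a: "0 < a" and b: "0 < b"
      using e wnorm_nonneg[of x] by (auto simp: a_def b_def add_nonneg_pos)
    have "seq_scale c' x' \<in> mball (seq_scale c x) e" if "c' \<in> ball c b" "x' \<in> mball x a" for c' x'
    proof -
      have c': "dist c c' < b" and x': "x' \<in> wl1" "wdist x x' < a" using that by auto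
      have split: "seq_scale c x - seq_scale c' x' = seq_scale (c - c') x + seq_scale c' (x - x')"
        by (auto simp: seq_scale_def algebra_simps)
      have "wdist (seq_scale c x) (seq_scale c' x') \<le> norm (c - c') * wnorm x + norm c' * wdist x x'"
        using wnorm_add(2)[OF seq_scale_mem[OF x] seq_scale_mem[OF diff_mem[OF x x'(1)]], of "c - c'" c']
          wnorm_seq_scale[OF x, of "c - c'"] wnorm_seq_scale[OF diff_mem[OF x x'(1)], of c']
        unfolding wdist_def split by simp
      also have "norm (c - c') * wnorm x \<le> e / (2 * (wnorm x + 1)) * wnorm x"
        using c' by (intro mult_right_mono wnorm_nonneg) (auto simp: b_def dist_norm)
      also have "\<dots> < e / 2"
        using e wnorm_nonneg[of x] by (simp add: field_simps add_nonneg_pos)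
      also have "norm c' * wdist x x' \<le> (norm c + 1) * a"
      proof (intro mult_mono)
        have "norm c' \<le> norm c + dist c c'"
          using norm_triangle_sub[of c' c] by (simp add: dist_norm norm_minus_commute)
        then show "norm c' \<le> norm c + 1" using c' by (simp add: b_def)
      qed (use x' in auto)
      also have "\<dots> = e / 2"
        using norm_ge_zero[of c] by (simp add: a_def field_simps del: norm_ge_zero)
      finally show ?thesis using x x' by (simp add: seq_scale_mem)
    qed
    moreover have "openin (prod_topology euclidean mtopology) (ball c b \<times> mball x a)"
      by (simp add: openin_prod_Times_iff)
    ultimately show "\<exists>U. openin (prod_topology euclidean mtopology) U \<and> p \<in> U \<and>
        (\<forall>q\<in>U. (case q of (c, x) \<Rightarrow> seq_scale c x) \<in> mball (case p of (c, x) \<Rightarrow> seq_scale c x) e)"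
      using x a b p by (intro exI[of _ "ball c b \<times> mball x a"]) auto
  qed
qed

lemma f_space_wtop: "f_space seq_scale (wtop :: (nat \<Rightarrow> 'k::{real_normed_field,banach}) topology)"
proof -
  interpret Metric_space "wl1 :: (nat \<Rightarrow> 'k) set" wdist by (rule Metric_space_wl1)
  interpret vs: vector_space "seq_scale :: 'k \<Rightarrow> _" by (rule vector_space_seq_scale)
  have "vs.subspace wl1"
    by (auto intro!: vs.subspaceI zero_mem wnorm_add(1) seq_scale_mem)
  then have "tvs_on seq_scale mtopology"
    unfolding tvs_on_def
    by (simp add: vector_space_seq_scale continuous_map_wtop_add continuous_map_wtop_scale)
  then show ?thesis
    unfolding f_space_def topspace_mtopology
    using Metric_space_wl1 mcomplete_wl1 wdist_add_right by blast
qed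

definition truncate :: "nat \<Rightarrow> (nat \<Rightarrow> 'k::zero) \<Rightarrow> nat \<Rightarrow> 'k"
  where "truncate N x = (\<lambda>n. if n < N then x n else 0)"

lemma truncate_mem: "truncate N x \<in> wl1"
  by (rule finite_support_mem(1)[of N]) (simp add: truncate_def)

lemma ex_truncate_close:
  assumes "x \<in> wl1" "e > 0"
  shows "\<exists>N. wdist x (truncate N x) < e"
proof -
  let ?f = "\<lambda>n. v n * norm (x n)"
  obtain F where F: "finite F" "dist (sum ?f F) (wnorm x) \<le> e / 2"
    using infsum_finite_approximation[of ?f UNIV "e / 2"] assms by (auto simp: wl1_def wnorm_def)
  obtain N where N: "F \<subseteq> {..<N}" using finite_nat_bounded[OF F(1)] by blast
  have "(\<Sum>n\<in>G. v n * norm ((x - truncate N x) n)) \<le> e / 2" if G: "finite G" for G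
  proof -
    have "(\<Sum>n\<in>G. v n * norm ((x - truncate N x) n)) = sum ?f (G - {..<N})"
      using G by (intro sum.mono_neutral_cong_right) (auto simp: truncate_def)
    also have "\<dots> + sum ?f F = sum ?f ((G - {..<N}) \<union> F)"
      using G F N by (intro sum.union_disjoint[symmetric]) auto
    also have "\<dots> \<le> wnorm x"
      using G F by (intro finite_sum_le_wnorm assms) auto
    finally show ?thesis using F(2) unfolding dist_real_def by linarith
  qed
  then have "wnorm (x - truncate N x) \<le> e / 2" by (rule wl1_finite_sums)
  then have "wdist x (truncate N x) < e" using assms(2) by (simp add: wdist_def)
  then show ?thesis ..
qed

text \<open>
  The dense set consists of the finitely supported sequences with entries in a countable dense set
  of scalars: truncating costs \<open>r / 2\<close>, and moving the \<open>N\<close> remaining entries costs another \<open>r / 2\<close>.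
\<close>

lemma separable_space_wtop:
  "separable_space (wtop :: (nat \<Rightarrow> 'k::{real_normed_field,second_countable_topology}) topology)"
proof -
  interpret Metric_space "wl1 :: (nat \<Rightarrow> 'k) set" wdist by (rule Metric_space_wl1)
  obtain D :: "'k set" where D: "countable D" "\<And>U. open U \<Longrightarrow> U \<noteq> {} \<Longrightarrow> \<exists>d\<in>D. d \<in> U"
    using countable_dense_exists by blast
  define seq :: "'k list \<Rightarrow> nat \<Rightarrow> 'k" where "seq ds = (\<lambda>n. if n < length ds then ds ! n else 0)" for ds
  have seq_mem: "seq ds \<in> wl1" for ds
    by (rule finite_support_mem(1)[of "length ds"]) (simp add: seq_def)
  have "\<exists>y\<in>seq ` lists D. y \<in> mball x r" if x: "x \<in> wl1" and r: "r > 0" for x r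
  proof -
    obtain N where N: "wdist x (truncate N x) < r / 2" using ex_truncate_close[OF x, of "r / 2"] r by auto
    \<comment> \<open>\<open>N\<close> entries, each of weight at most \<open>v 0\<close>; the \<open>+ 1\<close> covers \<open>N = 0\<close>\<close>
    define \<delta> where "\<delta> = r / (2 * (real N + 1) * v 0)"
    have \<delta>: "\<delta> > 0" unfolding \<delta>_def using r v_pos[of 0] by auto
    have "\<exists>d\<in>D. dist (x n) d < \<delta>" for n
      using D(2)[of "ball (x n) \<delta>"] \<delta> by auto
    then obtain d where d: "\<And>n. d n \<in> D" "\<And>n. dist (x n) (d n) < \<delta>" by metis
    let ?y = "seq (map d [0..<N])"
    have y: "?y n = (if n < N then d n else 0)" for n by (simp add: seq_def)
    have "wnorm (truncate N x - ?y) = (\<Sum>n<N. v n * norm ((truncate N x - ?y) n))"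
      by (rule finite_support_mem(2)) (simp add: truncate_def y)
    also have "\<dots> \<le> (\<Sum>n<N. v 0 * \<delta>)"
      using d(2) by (intro sum_mono mult_mono v_antimono v_nonneg)
        (auto simp: truncate_def y dist_norm less_imp_le)
    also have "v 0 * \<delta> = (r / 2) / (real N + 1)"
      using v_pos[of 0] by (simp add: \<delta>_def)
    also have "(\<Sum>n<N. (r / 2) / (real N + 1)) \<le> r / 2"
      using r by (simp add: field_simps)
    finally have "wdist x ?y < r"
      using wdist_triangle[OF x truncate_mem[of N x] seq_mem[of "map d [0..<N]"]] N
      unfolding wdist_def by linarith
    moreover have "?y \<in> seq ` lists D" using d(1) by (intro imageI) auto
    ultimately show ?thesis using x seq_mem by (intro bexI[of _ ?y]) auto
  qed
  then have "mtopology closure_of (seq ` lists D) = topspace mtopology"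
    by (auto simp: metric_closure_of)
  then show ?thesis
    unfolding separable_space_def using D(1) seq_mem by (intro exI[of _ "seq ` lists D"]) auto
qed

section \<open>The backward shift\<close>

definition bshift :: "(nat \<Rightarrow> 'k) \<Rightarrow> nat \<Rightarrow> 'k"
  where "bshift x = (\<lambda>n. x (Suc n))"

definition fshift :: "nat \<Rightarrow> (nat \<Rightarrow> 'k::zero) \<Rightarrow> nat \<Rightarrow> 'k"
  where "fshift n x = (\<lambda>m. if m < n then 0 else x (m - n))"

lemma bshift_funpow: "(bshift ^^ n) x = (\<lambda>m. x (m + n))"
  by (induction n) (auto simp: bshift_def)

lemma
  assumes "x \<in> wl1"
  shows bshift_mem: "bshift x \<in> wl1" and wnorm_bshift: "wnorm (bshift x) \<le> K * wnorm x"
proof -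
  have bound: "(\<Sum>n\<in>F. v n * norm (bshift x n)) \<le> K * wnorm x" if "finite F" for F
  proof -
    have "(\<Sum>n\<in>F. v n * norm (bshift x n)) \<le> (\<Sum>n\<in>F. K * (v (Suc n) * norm (x (Suc n))))"
      unfolding bshift_def mult.assoc[symmetric] by (intro sum_mono mult_right_mono v_shift) auto
    also have "\<dots> = K * (\<Sum>n\<in>Suc ` F. v n * norm (x n))"
      by (simp add: sum.reindex sum_distrib_left)
    also have "\<dots> \<le> K * wnorm x"
      using assms that by (intro mult_left_mono finite_sum_le_wnorm K_nonneg) auto
    finally show ?thesis .
  qed
  show "bshift x \<in> wl1" and "wnorm (bshift x) \<le> K * wnorm x"
    using wl1_finite_sums[of "bshift x", OF bound] by auto
qed

lemma continuous_linear_operator_bshift: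
  "continuous_linear_operator seq_scale (wtop :: (nat \<Rightarrow> 'k::real_normed_field) topology) bshift"
proof -
  interpret Metric_space "wl1 :: (nat \<Rightarrow> 'k) set" wdist by (rule Metric_space_wl1)
  have "continuous_map mtopology mtopology (bshift :: (nat \<Rightarrow> 'k) \<Rightarrow> _)"
    unfolding continuous_map_to_metric
  proof (clarsimp)
    fix x :: "nat \<Rightarrow> 'k" and e :: real
    assume *: "x \<in> wl1" "0 < e"
    have r: "0 < e / (K + 1)" using * K_nonneg by simp
    have "wdist (bshift x) (bshift y) < e" if y: "y \<in> wl1" "wdist x y < e / (K + 1)" for y
    proof -
      have "bshift x - bshift y = bshift (x - y)" by (auto simp: bshift_def)
      then have "wdist (bshift x) (bshift y) \<le> K * wdist x y"
        using wnorm_bshift[OF diff_mem[OF *(1) y(1)]] by (simp add: wdist_def)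
      also have "\<dots> \<le> (K + 1) * wdist x y" by (intro mult_right_mono) auto
      also have "\<dots> < e" using y(2) K_nonneg by (simp add: field_simps)
      finally show ?thesis .
    qed
    then show "\<exists>U. openin mtopology U \<and> x \<in> U \<and>
        (\<forall>y\<in>U. bshift x \<in> wl1 \<and> bshift y \<in> wl1 \<and> wdist (bshift x) (bshift y) < e)"
      using * r by (intro exI[of _ "mball x (e / (K + 1))"]) (auto simp: bshift_mem)
  qed
  then show ?thesis
    unfolding continuous_linear_operator_def by (auto simp: bshift_def seq_scale_def)
qed

text \<open>
  The forward shift moves all entries to places of weight at most \<open>v n\<close>, so for fixed \<open>y\<close> and \<open>N\<close> the
  preimages of a truncation under the powers of the backward shift tend to \<open>0\<close> as soon as \<open>v\<close> does.
\<close>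

lemma wnorm_fshift_truncate:
  "wnorm (fshift n (truncate N y)) \<le> v n * (\<Sum>m<N. norm (y m))"
proof -
  have "wnorm (fshift n (truncate N y)) = (\<Sum>m<n + N. v m * norm (fshift n (truncate N y) m))"
    by (rule finite_support_mem(2)) (auto simp: fshift_def truncate_def)
  also have "\<dots> = (\<Sum>m\<in>{n..<n + N}. v m * norm (y (m - n)))"
    by (intro sum.mono_neutral_cong_right) (auto simp: fshift_def truncate_def)
  also have "\<dots> = (\<Sum>m<N. v (n + m) * norm (y m))"
    by (rule sum.reindex_bij_witness[of _ "\<lambda>m. n + m" "\<lambda>m. m - n"]) auto
  also have "\<dots> \<le> (\<Sum>m<N. v n * norm (y m))"
    by (intro sum_mono mult_right_mono v_antimono) auto
  finally show ?thesis by (simp add: sum_distrib_left)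
qed

lemma fshift_truncate_mem: "fshift n (truncate N y) \<in> wl1"
  by (rule finite_support_mem(1)[of "n + N"]) (auto simp: fshift_def truncate_def)

lemma mixing_bshift:
  assumes "v \<longlonglongrightarrow> 0"
  shows "mixing (wtop :: (nat \<Rightarrow> 'k::real_normed_field) topology) bshift"
  unfolding mixing_def
proof (intro allI impI, elim conjE)
  interpret Metric_space "wl1 :: (nat \<Rightarrow> 'k) set" wdist by (rule Metric_space_wl1)
  fix U V :: "(nat \<Rightarrow> 'k) set"
  assume U: "openin mtopology U" "U \<noteq> {}" and V: "openin mtopology V" "V \<noteq> {}"
  obtain x r where x: "x \<in> wl1" "r > 0" "mball x r \<subseteq> U"
    using U unfolding openin_mtopology by blast
  obtain y s where y: "y \<in> wl1" "s > 0" "mball y s \<subseteq> V"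
    using V unfolding openin_mtopology by blast
  obtain M where M: "wdist x (truncate M x) < r / 2" using ex_truncate_close[of x "r/2"] x by auto
  obtain N where N: "wdist y (truncate N y) < s" using ex_truncate_close[of y s] y by auto
  have "(\<lambda>n. v n * (\<Sum>m<N. norm (y m))) \<longlonglongrightarrow> 0"
    using tendsto_mult_left_zero[OF assms] .
  then have "\<forall>\<^sub>F n in sequentially. v n * (\<Sum>m<N. norm (y m)) < r / 2"
    using x(2) by (intro order_tendstoD) auto
  then obtain L where L: "\<And>n. n \<ge> L \<Longrightarrow> v n * (\<Sum>m<N. norm (y m)) < r / 2"
    by (auto simp: eventually_sequentially)
  have "(bshift ^^ n) ` U \<inter> V \<noteq> {}" if n: "n \<ge> max L M" for n
  proof -
    \<comment> \<open>the \<open>n\<close>-th power of the shift kills the first summand and undoes the forward shift\<close>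
    define z where "z = truncate M x + fshift n (truncate N y)"
    have zmem: "z \<in> wl1" unfolding z_def by (intro wnorm_add truncate_mem fshift_truncate_mem)
    have "wdist x z \<le> wdist x (truncate M x) + wdist (truncate M x) z"
      using x(1) truncate_mem zmem by (rule wdist_triangle)
    also have "wdist (truncate M x) z = wnorm (fshift n (truncate N y))"
      unfolding wdist_commute[of _ z] by (simp add: wdist_def z_def)
    also have "wdist x (truncate M x) + \<dots> < r"
      using M L[of n] n wnorm_fshift_truncate[of n N y] by linarith
    finally have "z \<in> U" using x zmem by auto
    moreover have "(bshift ^^ n) z = truncate N y"
      using n by (auto simp: bshift_funpow z_def fshift_def truncate_def)
    moreover have "truncate N y \<in> V"
      using y N truncate_mem[of N y] by (intro subsetD[OF y(3)]) simp
    ultimately show ?thesis by (metis disjoint_iff imageI)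
  qed
  then show "\<exists>n0. \<forall>n\<ge>n0. (bshift ^^ n) ` U \<inter> V \<noteq> {}" by blast
qed

section \<open>Return times to a neighbourhood of the first unit vector\<close>

definition unit0 :: "nat \<Rightarrow> 'k::zero_neq_one"
  where "unit0 = (\<lambda>n. if n = 0 then 1 else 0)"

lemma unit0_mem: "unit0 \<in> wl1" and wnorm_unit0: "wnorm unit0 = v 0"
  using finite_support_mem[of 1 unit0] by (auto simp: unit0_def)

definition unit0_ball :: "(nat \<Rightarrow> 'k::real_normed_field) set"
  where "unit0_ball = Metric_space.mball wl1 wdist unit0 (v 0 / 2)"

lemma in_unit0_ball: "y \<in> unit0_ball \<longleftrightarrow> y \<in> wl1 \<and> wdist unit0 y < v 0 / 2"
proof -
  interpret Metric_space "wl1 :: (nat \<Rightarrow> 'a) set" wdist by (rule Metric_space_wl1)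
  show ?thesis by (simp add: unit0_ball_def unit0_mem)
qed

lemma
  fixes y :: "nat \<Rightarrow> 'k::real_normed_field"
  assumes "y \<in> unit0_ball"
  shows unit0_ball_coord: "1 / 2 < norm (y 0)" and unit0_ball_wnorm: "wnorm y < 3 / 2 * v 0"
proof -
  have y: "y \<in> wl1" "wdist unit0 y < v 0 / 2" using assms by (auto simp: in_unit0_ball)
  have "v 0 * norm (1 - y 0) < v 0 * (1 / 2)"
    using coord_le_wnorm[OF diff_mem[OF unit0_mem y(1)], of 0] y(2)
    by (simp add: wdist_def unit0_def)
  then have "norm (1 - y 0) < 1 / 2" using v_pos[of 0] by simp
  then show "1 / 2 < norm (y 0)" using norm_triangle_ineq2[of 1 "1 - y 0"] by (simp add: norm_minus_commute)
  have "wnorm y \<le> wnorm (y - unit0) + wnorm (unit0 :: nat \<Rightarrow> 'k)"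
    using wnorm_add(2)[OF diff_mem[OF y(1) unit0_mem] unit0_mem] by simp
  then show "wnorm y < 3 / 2 * v 0"
    using y(2) unfolding wdist_commute[of unit0] by (simp add: wdist_def wnorm_unit0)
qed

text \<open>
  All return times in the window are visible in the single vector \<open>T\<^sup>n x\<close>, where \<open>n\<close> is the first of
  them: a return time \<open>m\<close> is an entry \<open>x m\<close> of modulus above \<open>1/2\<close> at position \<open>m - n \<le> s\<close>, whose weight
  is at least \<open>v s\<close>.  The norm of \<open>T\<^sup>n x\<close> is bounded as \<open>n\<close> is a return time, and this limits their
  number, independently of \<open>k\<close> and \<open>x\<close>.
\<close>

lemma card_return_set_window:
  "real (card (return_set bshift x unit0_ball \<inter> {k + 1..k + s})) \<le> 3 * v 0 / v s"
proof (cases "return_set bshift x unit0_ball \<inter> {k + 1..k + s} = {}")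
  case True
  then show ?thesis using v_nonneg by simp
next
  case False
  define A where "A = return_set bshift x unit0_ball \<inter> {k + 1..k + s}"
  define n where "n = Min A"
  have A: "finite A" "A \<noteq> {}" using False by (auto simp: A_def)
  have n: "n \<in> A" "\<And>m. m \<in> A \<Longrightarrow> n \<le> m" using A by (auto simp: n_def)
  have ret: "(\<lambda>j. x (j + m)) \<in> unit0_ball" if "m \<in> A" for m
    using that by (simp add: A_def return_set_def bshift_funpow)
  have big: "1 / 2 < norm (x m)" if "m \<in> A" for m
    using unit0_ball_coord[OF ret[OF that]] by simp
  have "real (card A) * (v s * (1 / 2)) = (\<Sum>m\<in>A. v s * (1 / 2))" by simp
  also have "\<dots> \<le> (\<Sum>m\<in>A. v (m - n) * norm (x m))"
  proof (intro sum_mono mult_mono v_antimono v_nonneg)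
    fix m assume m: "m \<in> A"
    then show "m - n \<le> s" using n(1) by (auto simp: A_def)
    show "1 / 2 \<le> norm (x m)" using big[OF m] by simp
  qed auto
  also have "\<dots> = (\<Sum>j\<in>(\<lambda>m. m - n) ` A. v j * norm (x (j + n)))"
    using n(2) by (subst sum.reindex) (auto simp: inj_on_def eq_diff_iff)
  also have "\<dots> \<le> wnorm (\<lambda>j. x (j + n))"
    using ret[OF n(1)] A(1) by (intro finite_sum_le_wnorm) (auto simp: in_unit0_ball)
  also have "\<dots> < 3 / 2 * v 0" by (rule unit0_ball_wnorm[OF ret[OF n(1)]])
  finally show ?thesis using v_pos[of s] by (simp add: A_def field_simps)
qed

lemma upper_banach_density_return_set:
  assumes "filterlim (\<lambda>n. real n * v n) at_top sequentially"
  shows "upper_banach_density (return_set bshift x unit0_ball) \<le> 0"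
proof (rule LIMSEQ_le[OF banach_alpha_quotient_tendsto])
  let ?A = "return_set bshift x unit0_ball"
  have "(\<lambda>s. 3 * v 0 / (real s * v s)) \<longlonglongrightarrow> 0"
    by (rule real_tendsto_divide_at_top[OF tendsto_const assms])
  then show "(\<lambda>s. ereal (3 * v 0 / (real s * v s))) \<longlonglongrightarrow> 0"
    by (simp add: zero_ereal_def)
  have "banach_alpha ?A s / ereal (real s) \<le> ereal (3 * v 0 / (real s * v s))" if "s \<ge> 1" for s
  proof -
    have "banach_alpha ?A s \<le> ereal (3 * v 0 / v s)"
      unfolding banach_alpha_def
      by (intro Limsup_bounded always_eventually allI) (simp only: ereal_less_eq card_return_set_window)
    then have "banach_alpha ?A s / ereal (real s) \<le> ereal (3 * v 0 / v s) / ereal (real s)"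
      using that by (intro ereal_divide_right_mono) auto
    then show ?thesis using that by (simp add: mult.commute)
  qed
  then show "\<exists>N. \<forall>s\<ge>N. banach_alpha ?A s / ereal (real s) \<le> ereal (3 * v 0 / (real s * v s))"
    by blast
qed

lemma not_reiteratively_hypercyclic_bshift:
  assumes "filterlim (\<lambda>n. real n * v n) at_top sequentially"
  shows "\<not> reiteratively_hypercyclic (wtop :: (nat \<Rightarrow> 'k::real_normed_field) topology) bshift"
proof -
  interpret Metric_space "wl1 :: (nat \<Rightarrow> 'k) set" wdist by (rule Metric_space_wl1)
  have "openin mtopology (unit0_ball :: (nat \<Rightarrow> 'k) set)" by (simp add: unit0_ball_def)
  moreover have "unit0 \<in> unit0_ball"
    using v_pos[of 0] by (simp add: in_unit0_ball unit0_mem wdist_def wnorm_zero)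
  ultimately show ?thesis
    using upper_banach_density_return_set[OF assms]
    unfolding reiteratively_hypercyclic_def by (metis empty_iff leD)
qed

end

section \<open>A weight that decays slowly\<close>

lemma decreasing_weight_inverse_sqrt: "decreasing_weight (\<lambda>n. 1 / sqrt (real n + 1)) 2"
proof
  fix m n :: nat
  show "0 < 1 / sqrt (real n + 1)" by simp
  show "1 / sqrt (real n + 1) \<le> 1 / sqrt (real m + 1)" if "m \<le> n"
    using that by (intro divide_left_mono) auto
  have "sqrt (real (Suc n) + 1) \<le> sqrt (4 * (real n + 1))" by (intro real_sqrt_le_mono) auto
  also have "\<dots> = 2 * sqrt (real n + 1)" by (simp add: real_sqrt_mult del: distrib_left_numeral)
  finally show "1 / sqrt (real n + 1) \<le> 2 * (1 / sqrt (real (Suc n) + 1))"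
    by (simp add: field_simps)
qed

lemma ex_mixing_not_reiteratively_hypercyclic:
  "\<exists>(X :: (nat \<Rightarrow> 'k::{real_normed_field,banach,second_countable_topology}) topology) T.
      f_space seq_scale X \<and> separable_space X \<and>
      continuous_linear_operator seq_scale X T \<and>
      mixing X T \<and> \<not> reiteratively_hypercyclic X T"
proof -
  interpret decreasing_weight "\<lambda>n. 1 / sqrt (real n + 1)" 2
    by (rule decreasing_weight_inverse_sqrt)
  have "(\<lambda>n. 1 / sqrt (real n + 1)) \<longlonglongrightarrow> 0" by real_asymp
  moreover have "filterlim (\<lambda>n. real n * (1 / sqrt (real n + 1))) at_top sequentially"
    by real_asymp
  ultimately show ?thesis
    using f_space_wtop separable_space_wtop continuous_linear_operator_bshift mixing_bshift
      not_reiteratively_hypercyclic_bshift by blast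
qed

theorem theorem24:
  shows "(\<exists>(X :: (nat \<Rightarrow> real) topology) T.
            f_space seq_scale X \<and> separable_space X \<and>
            continuous_linear_operator seq_scale X T \<and>
            mixing X T \<and> \<not> reiteratively_hypercyclic X T) \<and>
         (\<exists>(X :: (nat \<Rightarrow> complex) topology) T.
            f_space seq_scale X \<and> separable_space X \<and>
            continuous_linear_operator seq_scale X T \<and>
            mixing X T \<and> \<not> reiteratively_hypercyclic X T)"
  by (intro conjI ex_mixing_not_reiteratively_hypercyclic)

end
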